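(* Let $\mathcal{Q}\subseteq\omega\times 2^\omega$ be a universal $\Pi^1_1$ set, let $x_0=\{n\mid \mu(\mathcal{Q}_n)=0\}$, and let $$\mathfrak{c}=\{(n,\sigma)\in\omega\times 2^{<\omega}\mid n\in x_0\ \wedge\ \exists x\,((n,x)\in\mathcal{Q}\wedge \sigma\prec x)\},$$ viewed as a real via a recursive coding of $\omega\times 2^{<\omega}$ by $\omega$. Then the hyperdegree of $\mathfrak{c}$ is a base for a cone of $\Pi^1_1$-Kurtz randoms: for every real $y_0\geq_h\mathfrak{c}$ there is a real $z\equiv_h y_0$ which is $\Pi^1_1$-Kurtz random.
   Context: $\mu$ is the uniform measure on $2^\omega$; $\leq_h$ is hyperarithmetic reducibility and $\equiv_h$ the induced equivalence. A universal $\Pi^1_1$ set is a $\Pi^1_1$ set $\mathcal{Q}\subseteq\omega\times2^\omega$ such that every $\Pi^1_1$ subset of $2^\omega$ equals $\mathcal{Q}_n=\{x\mid(n,x)\in\mathcal{Q}\}$ for some $n$. A real is $\Pi^1_1$-Kurtz random if it belongs to no closed $\mu$-null $\Pi^1_1$ subset of $2^\omega$. A hyperdegree $\mathbf d$ is a base for a cone of $\Pi^1_1$-Kurtz randoms if every hyperdegree $\mathbf h\geq\mathbf d$ contains a $\Pi^1_1$-Kurtz random real. *)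

theory Defs
  imports "HOL-Probability.Probability" "HOL-Library.Nat_Bijection"
begin

type_synonym cantor = "nat \<Rightarrow> bool"

text \<open>Reals are elements of Cantor space, identified with sets of natural numbers. The topology
  on \<^typ>\<open>cantor\<close> is the library's product topology (of the discrete topology on \<^typ>\<open>bool\<close>).\<close>


section \<open>The lightface class \<open>\<Pi>\<^sup>1\<^sub>1\<close>\<close>

text \<open>Arithmetical formulas of second-order arithmetic: only number quantifiers, with set
  variables occurring free. Both sorts of variables are de Bruijn indices; \<open>All\<close> binds the
  number variable 0.\<close>

datatype tm = Var nat | Zero | S tm | Plus tm tm | Times tm tm

datatype arith = Eq tm tm | Mem tm nat | Neg arith | And arith arith | All arith

primrec val :: "(nat \<Rightarrow> nat) \<Rightarrow> tm \<Rightarrow> nat" where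
  "val e (Var i) = e i"
| "val e Zero = 0"
| "val e (S t) = Suc (val e t)"
| "val e (Plus s t) = val e s + val e t"
| "val e (Times s t) = val e s * val e t"

primrec sat :: "(nat \<Rightarrow> nat) \<Rightarrow> (nat \<Rightarrow> cantor) \<Rightarrow> arith \<Rightarrow> bool" where
  "sat e X (Eq s t) \<longleftrightarrow> val e s = val e t"
| "sat e X (Mem t i) \<longleftrightarrow> X i (val e t)"
| "sat e X (Neg p) \<longleftrightarrow> \<not> sat e X p"
| "sat e X (And p q) \<longleftrightarrow> sat e X p \<and> sat e X q"
| "sat e X (All p) \<longleftrightarrow> (\<forall>k. sat (case_nat k e) X p)"

text \<open>\<open>\<Pi>\<^sup>1\<^sub>1\<close> sets are those defined by a parameter-free formula \<open>\<forall>W. \<phi>\<close> with \<open>\<phi>\<close> arithmetical: set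
  variable 0 is \<open>W\<close>, set variable 1 is the argument from Cantor space, number variable 0 is the
  number argument. Variables that stand for nothing are evaluated to 0 and to the empty set, so
  they do not introduce parameters.\<close>

definition pi11_pairs :: "(nat \<times> cantor) set \<Rightarrow> bool" where
  "pi11_pairs P \<longleftrightarrow> (\<exists>\<phi>. P = {(n, x). \<forall>w.
     sat (case_nat n (\<lambda>_. 0)) (case_nat w (case_nat x (\<lambda>_ _. False))) \<phi>})"

definition pi11 :: "cantor set \<Rightarrow> bool" where
  "pi11 A \<longleftrightarrow> (\<exists>\<phi>. A = {x. \<forall>w.
     sat (\<lambda>_. 0) (case_nat w (case_nat x (\<lambda>_ _. False))) \<phi>})"

definition slice :: "(nat \<times> cantor) set \<Rightarrow> nat \<Rightarrow> cantor set" where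
  "slice Q n = {x. (n, x) \<in> Q}"

definition universal_pi11 :: "(nat \<times> cantor) set \<Rightarrow> bool" where
  "universal_pi11 Q \<longleftrightarrow> pi11_pairs Q \<and> (\<forall>A. pi11 A \<longrightarrow> (\<exists>n. A = slice Q n))"


section \<open>Hyperarithmetic reducibility and hyperdegrees\<close>

text \<open>\<open>x \<le>\<^sub>h y\<close> means that \<open>x\<close> is \<open>\<Delta>\<^sup>1\<^sub>1(y)\<close>, that is, both \<open>x\<close> and its complement are \<open>\<Pi>\<^sup>1\<^sub>1\<close>
  relative to \<open>y\<close>. A \<open>\<Pi>\<^sup>1\<^sub>1(y)\<close> set of numbers is \<open>{n. (n, y) \<in> P}\<close> for a lightface \<open>\<Pi>\<^sup>1\<^sub>1\<close> set \<open>P\<close>.\<close>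

definition hyp_le :: "cantor \<Rightarrow> cantor \<Rightarrow> bool" (infix "\<le>\<^sub>h" 50) where
  "x \<le>\<^sub>h y \<longleftrightarrow> (\<exists>P R. pi11_pairs P \<and> pi11_pairs R \<and>
     {n. x n} = {n. (n, y) \<in> P} \<and> - {n. x n} = {n. (n, y) \<in> R})"

definition hyp_equiv :: "cantor \<Rightarrow> cantor \<Rightarrow> bool" (infix "\<equiv>\<^sub>h" 50) where
  "x \<equiv>\<^sub>h y \<longleftrightarrow> x \<le>\<^sub>h y \<and> y \<le>\<^sub>h x"

definition hyperdegree :: "cantor \<Rightarrow> cantor set" where
  "hyperdegree x = {z. z \<equiv>\<^sub>h x}"

definition hyperdegree_le :: "cantor set \<Rightarrow> cantor set \<Rightarrow> bool" where
  "hyperdegree_le d h \<longleftrightarrow> (\<exists>x\<in>d. \<exists>y\<in>h. x \<le>\<^sub>h y)"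


section \<open>Measure and Kurtz randomness\<close>

definition coin_measure :: "cantor measure" where
  "coin_measure = Pi\<^sub>M UNIV (\<lambda>_. measure_pmf (bernoulli_pmf (1/2)))"

text \<open>\<open>\<Pi>\<^sup>1\<^sub>1\<close> sets need not be Borel, and \<^const>\<open>emeasure\<close> returns 0 on non-measurable sets, so
  nullness has to be taken in the completion.\<close>

definition mu_null :: "cantor set \<Rightarrow> bool" where
  "mu_null A \<longleftrightarrow> A \<in> null_sets (completion coin_measure)"

definition pi11_kurtz_random :: "cantor \<Rightarrow> bool" where
  "pi11_kurtz_random x \<longleftrightarrow> \<not> (\<exists>A. closed A \<and> mu_null A \<and> pi11 A \<and> x \<in> A)"

definition kurtz_cone_base :: "cantor set \<Rightarrow> bool" where
  "kurtz_cone_base d \<longleftrightarrow>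
     (\<forall>h\<in>range hyperdegree. hyperdegree_le d h \<longrightarrow> (\<exists>z\<in>h. pi11_kurtz_random z))"


section \<open>Finite strings\<close>

definition initial_segment :: "bool list \<Rightarrow> cantor \<Rightarrow> bool" (infix "\<prec>" 50) where
  "\<sigma> \<prec> x \<longleftrightarrow> (\<forall>i<length \<sigma>. \<sigma> ! i = x i)"

text \<open>Bijective base-2 numeration, a recursive bijection between finite binary strings and the
  natural numbers.\<close>

primrec string_code :: "bool list \<Rightarrow> nat" where
  "string_code [] = 0"
| "string_code (b # \<sigma>) = 2 * string_code \<sigma> + (if b then 2 else 1)"

definition real_of_pairs :: "(nat \<times> bool list) set \<Rightarrow> cantor" where
  "real_of_pairs C = (\<lambda>k. k \<in> (\<lambda>(n, \<sigma>). prod_encode (n, string_code \<sigma>)) ` C)"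

end

theory Submission
  imports Defs
begin

text \<open>Split \<open>\<omega>\<close> into blocks \<open>[j\<^sup>2, (j + 1)\<^sup>2)\<close>. Inside any cylinder the sequences all of whose
  later blocks are nonzero have positive measure, so a closed null set can always be left by a finite
  extension without zero blocks. Stage \<open>n\<close> of the construction of \<open>z\<close> takes the least such extension
  leaving \<open>Q\<^sub>n\<close>, which \<open>c\<close> can recognize, and then appends ones up to a block whose number has the
  form \<open>pr n b\<close>; that block is zero if \<open>y n\<close> holds and filled with ones otherwise. Hence \<open>y n\<close> holds
  iff some block \<open>pr n k\<close> of \<open>z\<close> is zero, and \<open>y\<close> is recovered from \<open>z\<close> without knowing \<open>c\<close>.
  Conversely \<open>z\<close> is the unique solution of an arithmetical condition on \<open>c\<close> and \<open>y\<close>, hence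
  hyperarithmetic in \<open>y\<close>.\<close>


section \<open>Arithmetical relations\<close>

text \<open>Terms and formulas are treated semantically: definability follows from closure rules for
  functions and relations of environments, so large conditions need not be written in de Bruijn
  syntax.\<close>

definition numfun :: "((nat \<Rightarrow> nat) \<Rightarrow> nat) \<Rightarrow> bool" where
  "numfun f \<longleftrightarrow> (\<exists>t. \<forall>e. f e = val e t)"

definition arithmetical :: "((nat \<Rightarrow> nat) \<Rightarrow> (nat \<Rightarrow> cantor) \<Rightarrow> bool) \<Rightarrow> bool" where
  "arithmetical R \<longleftrightarrow> (\<exists>\<phi>. \<forall>e X. R e X \<longleftrightarrow> sat e X \<phi>)"

lemma numfun_var: "numfun (\<lambda>e. e i)"
  unfolding numfun_def by (rule exI[of _ "Var i"]) simp

lemma numfun_Suc: "numfun f \<Longrightarrow> numfun (\<lambda>e. Suc (f e))"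
  unfolding numfun_def by (metis val.simps(3))

lemma numfun_const: "numfun (\<lambda>e. k)"
proof (induction k)
  case 0
  show ?case unfolding numfun_def by (rule exI[of _ Zero]) simp
qed (rule numfun_Suc)

lemma numfun_plus: "numfun f \<Longrightarrow> numfun g \<Longrightarrow> numfun (\<lambda>e. f e + g e)"
  unfolding numfun_def by (metis val.simps(4))

lemma numfun_times: "numfun f \<Longrightarrow> numfun g \<Longrightarrow> numfun (\<lambda>e. f e * g e)"
  unfolding numfun_def by (metis val.simps(5))

lemma numfun_val: "(\<And>i. numfun (f i)) \<Longrightarrow> numfun (\<lambda>e. val (\<lambda>i. f i e) t)"
  by (induction t) (auto intro: numfun_const numfun_Suc numfun_plus numfun_times)

lemma numfun_comp:
  assumes "numfun F" "\<And>i. numfun (f i)"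
  shows "numfun (\<lambda>e. F (\<lambda>i. f i e))"
proof -
  obtain t where "F e = val e t" for e
    using assms(1) unfolding numfun_def by blast
  then show ?thesis using numfun_val[of f t] assms(2) by simp
qed

lemma arithmetical_eq:
  assumes "numfun f" "numfun g"
  shows "arithmetical (\<lambda>e X. f e = g e)"
proof -
  obtain s t where "\<And>e. f e = val e s" "\<And>e. g e = val e t"
    using assms unfolding numfun_def by blast
  then show ?thesis unfolding arithmetical_def by (intro exI[of _ "Eq s t"]) simp
qed

lemma arithmetical_mem:
  assumes "numfun f"
  shows "arithmetical (\<lambda>e X. X i (f e))"
proof -
  obtain t where "\<And>e. f e = val e t"
    using assms unfolding numfun_def by blast
  then show ?thesis unfolding arithmetical_def by (intro exI[of _ "Mem t i"]) simp
qed

lemma arithmetical_not: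
  assumes "arithmetical R"
  shows "arithmetical (\<lambda>e X. \<not> R e X)"
proof -
  obtain \<phi> where "\<And>e X. R e X \<longleftrightarrow> sat e X \<phi>"
    using assms unfolding arithmetical_def by blast
  then show ?thesis unfolding arithmetical_def by (intro exI[of _ "Neg \<phi>"]) simp
qed

lemma arithmetical_conj:
  assumes "arithmetical R" "arithmetical G"
  shows "arithmetical (\<lambda>e X. R e X \<and> G e X)"
proof -
  obtain \<phi> \<psi> where "\<And>e X. R e X \<longleftrightarrow> sat e X \<phi>" "\<And>e X. G e X \<longleftrightarrow> sat e X \<psi>"
    using assms unfolding arithmetical_def by blast
  then show ?thesis unfolding arithmetical_def by (intro exI[of _ "And \<phi> \<psi>"]) simp
qed

text \<open>The premise reads the bound number as variable 0 and shifts the others, as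
  \<open>All\<close> does; in this shape the rule can be applied repeatedly under nested
  quantifiers.\<close>

lemma arithmetical_all:
  assumes "arithmetical (\<lambda>e X. R (e 0) (\<lambda>i. e (Suc i)) X)"
  shows "arithmetical (\<lambda>e X. \<forall>k. R k e X)"
proof -
  obtain \<phi> where \<phi>: "\<forall>e X. R (e 0) (\<lambda>i. e (Suc i)) X \<longleftrightarrow> sat e X \<phi>"
    using assms unfolding arithmetical_def by (rule exE)
  have "R k e X \<longleftrightarrow> sat (case_nat k e) X \<phi>" for k e X
    using \<phi>[rule_format, of "case_nat k e" X] by simp
  then show ?thesis unfolding arithmetical_def by (intro exI[of _ "All \<phi>"]) simp
qed

lemma arithmetical_disj:
  assumes "arithmetical R" "arithmetical G"
  shows "arithmetical (\<lambda>e X. R e X \<or> G e X)"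
proof -
  have "arithmetical (\<lambda>e X. \<not> (\<not> R e X \<and> \<not> G e X))"
    by (intro arithmetical_not arithmetical_conj assms)
  then show ?thesis by (simp only: de_Morgan_conj not_not)
qed

lemma arithmetical_imp:
  "arithmetical R \<Longrightarrow> arithmetical G \<Longrightarrow> arithmetical (\<lambda>e X. R e X \<longrightarrow> G e X)"
  unfolding imp_conv_disj by (intro arithmetical_disj arithmetical_not)

lemma arithmetical_iff:
  "arithmetical R \<Longrightarrow> arithmetical G \<Longrightarrow> arithmetical (\<lambda>e X. R e X \<longleftrightarrow> G e X)"
  unfolding iff_conv_conj_imp by (intro arithmetical_conj arithmetical_imp)

lemma arithmetical_ex:
  assumes "arithmetical (\<lambda>e X. R (e 0) (\<lambda>i. e (Suc i)) X)"
  shows "arithmetical (\<lambda>e X. \<exists>k. R k e X)"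
proof -
  have "arithmetical (\<lambda>e X. \<not> (\<forall>k. \<not> R k e X))"
    by (intro arithmetical_not arithmetical_all assms)
  then show ?thesis by (simp only: not_all not_not)
qed

lemma arithmetical_const: "arithmetical (\<lambda>e X. b)"
proof (cases b)
  case True
  then show ?thesis
    using arithmetical_eq[OF numfun_const numfun_const, of 0 0] by simp
next
  case False
  then show ?thesis
    using arithmetical_eq[OF numfun_const numfun_const, of 0 1] by simp
qed

lemma arithmetical_le:
  assumes "numfun f" "numfun g"
  shows "arithmetical (\<lambda>e X. f e \<le> g e)"
  unfolding le_iff_add
  by (intro arithmetical_ex arithmetical_eq numfun_plus numfun_var numfun_comp[OF assms(1)]
      numfun_comp[OF assms(2)])

lemma arithmetical_less:
  "numfun f \<Longrightarrow> numfun g \<Longrightarrow> arithmetical (\<lambda>e X. f e < g e)"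
  unfolding less_eq_Suc_le by (intro arithmetical_le numfun_Suc)

lemmas arithmetical_intros =
  numfun_var numfun_Suc numfun_const numfun_plus numfun_times
  arithmetical_eq arithmetical_mem arithmetical_not arithmetical_conj arithmetical_disj
  arithmetical_imp arithmetical_iff arithmetical_all arithmetical_ex arithmetical_le
  arithmetical_less

text \<open>Substitution by induction on the formula: number variables become terms, and set
  variable \<open>i\<close> becomes the preimage of \<open>X (g i)\<close> under the term function
  \<open>h i\<close>, or the empty set if \<open>B i\<close> is false. Columns of a set are such
  preimages.\<close>

lemma arithmetical_sat:
  assumes "\<And>i. numfun (f i)" "\<And>i. numfun (\<lambda>e. h i (e 0) (\<lambda>j. e (Suc j)))"
  shows "arithmetical (\<lambda>e X. sat (\<lambda>i. f i e) (\<lambda>i q. B i \<and> X (g i) (h i q e)) \<phi>)"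
  using assms
proof (induction \<phi> arbitrary: f h)
  case (Eq s t)
  then show ?case unfolding sat.simps by (intro arithmetical_eq numfun_val)
next
  case (Mem t i)
  define v where "v k = (case k of 0 \<Rightarrow> \<lambda>e. val (\<lambda>i. f i e) t | Suc j \<Rightarrow> \<lambda>e. e j)" for k
  have "numfun (v k)" for k
    unfolding v_def by (auto split: nat.split intro: numfun_val numfun_var Mem(1))
  from numfun_comp[OF Mem(2)[of i], of v, OF this]
  have "numfun (\<lambda>e. h i (val (\<lambda>i. f i e) t) e)"
    by (simp add: v_def)
  then show ?case
    unfolding sat.simps by (intro arithmetical_conj arithmetical_const arithmetical_mem)
next
  case (Neg \<phi>)
  then show ?case unfolding sat.simps by (intro arithmetical_not Neg.IH)
next
  case (And \<phi> \<psi>)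
  then show ?case unfolding sat.simps by (intro arithmetical_conj And.IH)
next
  case (All \<phi>)
  define f' where "f' i = (case i of 0 \<Rightarrow> \<lambda>e. e 0 | Suc i \<Rightarrow> \<lambda>e. f i (\<lambda>j. e (Suc j)))" for i
  define h' where "h' i q e = h i q (\<lambda>j. e (Suc j))" for i q and e :: "nat \<Rightarrow> nat"
  have f': "numfun (f' i)" for i
    unfolding f'_def using numfun_comp[OF All(2), of "\<lambda>j e. e (Suc j)"]
    by (simp add: numfun_var split: nat.split)
  \<comment> \<open>Variable 0 is the queried number and variable 1 the newly bound one, which
    \<open>h\<close> must skip.\<close>
  define v :: "nat \<Rightarrow> (nat \<Rightarrow> nat) \<Rightarrow> nat"
    where "v k = (case k of 0 \<Rightarrow> \<lambda>e. e 0 | Suc j \<Rightarrow> \<lambda>e. e (Suc (Suc j)))" for k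
  have "numfun (v k)" for k
    unfolding v_def by (auto split: nat.split intro: numfun_var)
  from numfun_comp[OF All(3), of v, OF this]
  have h': "numfun (\<lambda>e. h' i (e 0) (\<lambda>j. e (Suc j)))" for i
    by (simp add: h'_def v_def)
  have env: "(\<lambda>i. f' i e) = case_nat (e 0) (\<lambda>i. f i (\<lambda>j. e (Suc j)))" for e
    by (auto simp: f'_def split: nat.split)
  show ?case
    using All(1)[of f' h', OF f' h']
      arithmetical_all[of "\<lambda>k e X. sat (case_nat k (\<lambda>i. f i e)) (\<lambda>i q. B i \<and> X (g i) (h i q e)) \<phi>"]
    unfolding env h'_def sat.simps by blast
qed

lemma arithmetical_subst:
  assumes G: "arithmetical (\<lambda>e X. G (e 0) (X 0) (X 1) (X 2))"
    and f: "numfun f"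
    and h: "numfun (\<lambda>e. h0 (e 0) (\<lambda>j. e (Suc j)))" "numfun (\<lambda>e. h1 (e 0) (\<lambda>j. e (Suc j)))"
      "numfun (\<lambda>e. h2 (e 0) (\<lambda>j. e (Suc j)))"
  shows "arithmetical (\<lambda>e X. G (f e) (\<lambda>q. X i0 (h0 q e)) (\<lambda>q. X i1 (h1 q e)) (\<lambda>q. X i2 (h2 q e)))"
proof -
  obtain \<phi> where \<phi>: "\<forall>e X. G (e 0) (X 0) (X 1) (X 2) \<longleftrightarrow> sat e X \<phi>"
    using G unfolding arithmetical_def by (rule exE)
  define h where "h = case_nat h0 (case_nat h1 (\<lambda>_. h2))"
  have "numfun (\<lambda>e. h i (e 0) (\<lambda>j. e (Suc j)))" for i
    using h by (cases i; cases "i - 1") (simp_all add: h_def)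
  from arithmetical_sat[where f = "\<lambda>_. f" and h = h and B = "\<lambda>_. True" and g = "case_nat i0 (case_nat i1 (\<lambda>_. i2))"
      and \<phi> = \<phi>, OF f this]
  show ?thesis
    unfolding \<phi>[rule_format, symmetric] by (simp add: h_def numeral_2_eq_2)
qed

lemma pi11_pairsI:
  assumes "arithmetical (\<lambda>e X. G (e 0) (X 0) (X 1))"
  shows "pi11_pairs {(n, x). \<forall>w. G n w x}"
proof -
  obtain \<phi> where \<phi>: "\<forall>e X. G (e 0) (X 0) (X 1) \<longleftrightarrow> sat e X \<phi>"
    using assms unfolding arithmetical_def by (rule exE)
  show ?thesis
    unfolding pi11_pairs_def by (rule exI[of _ \<phi>]) (simp add: \<phi>[rule_format, symmetric])
qed

text \<open>Evaluation in environments padded with 0 and the empty set is a substitution instance,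
  hence an arithmetical relation of the three displayed arguments alone.\<close>

lemma pi11_pairsE:
  assumes "pi11_pairs P"
  obtains G where "arithmetical (\<lambda>e X. G (e 0) (X 0) (X 1))" "P = {(n, x). \<forall>w. G n w x}"
proof -
  obtain \<phi> where \<phi>: "P = {(n, x). \<forall>w.
     sat (case_nat n (\<lambda>_. 0)) (case_nat w (case_nat x (\<lambda>_ _. False))) \<phi>}"
    using assms unfolding pi11_pairs_def by (rule exE)
  have f: "numfun (case i of 0 \<Rightarrow> \<lambda>e. e 0 | Suc j \<Rightarrow> \<lambda>e. 0)" for i
    by (cases i) (simp_all add: numfun_var numfun_const)
  have env: "(\<lambda>i. (case i of 0 \<Rightarrow> \<lambda>e. e 0 | Suc j \<Rightarrow> \<lambda>e. 0) e) = case_nat (e 0) (\<lambda>_. 0)"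
    for e :: "nat \<Rightarrow> nat"
  proof
    show "(case i of 0 \<Rightarrow> \<lambda>e. e 0 | Suc j \<Rightarrow> \<lambda>e. 0) e = case_nat (e 0) (\<lambda>_. 0) i" for i
      by (cases i) simp_all
  qed
  have sets: "(\<lambda>i q. i < 2 \<and> X i q) = case_nat (X 0) (case_nat (X 1) (\<lambda>_ _. False))"
    for X :: "nat \<Rightarrow> cantor"
  proof
    show "(\<lambda>q. i < 2 \<and> X i q) = case_nat (X 0) (case_nat (X 1) (\<lambda>_ _. False)) i" for i
      by (cases i; cases "i - 1") simp_all
  qed
  have "arithmetical (\<lambda>e X. sat (case_nat (e 0) (\<lambda>_. 0))
      (case_nat (X 0) (case_nat (X 1) (\<lambda>_ _. False))) \<phi>)"
    using arithmetical_sat[where f = "\<lambda>i. case i of 0 \<Rightarrow> \<lambda>e. e 0 | Suc j \<Rightarrow> \<lambda>e. 0"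
        and h = "\<lambda>i q e. q" and B = "\<lambda>i. i < 2" and g = "\<lambda>i. i" and \<phi> = \<phi>,
        OF f numfun_var]
    unfolding env sets .
  then show ?thesis
    by (rule that[of "\<lambda>n w x. sat (case_nat n (\<lambda>_. 0)) (case_nat w (case_nat x (\<lambda>_ _. False))) \<phi>",
          OF _ \<phi>])
qed


section \<open>Definability relative to a hyperarithmetic real\<close>

text \<open>Unlike \<^const>\<open>prod_encode\<close>, this pairing is a polynomial with natural coefficients, so
  that it is a term of the language.\<close>

definition pr :: "nat \<Rightarrow> nat \<Rightarrow> nat" where
  "pr a b = (a + b) * (a + b) + a"

lemma numfun_pr: "numfun f \<Longrightarrow> numfun g \<Longrightarrow> numfun (\<lambda>e. pr (f e) (g e))"
  unfolding pr_def by (intro numfun_plus numfun_times)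

text \<open>The value \<open>pr a b\<close> is at least the square of \<open>a + b\<close> and below
  the next square, so it determines the sum and then \<open>a\<close>.\<close>

lemma pr_eq_iff [simp]: "pr a b = pr c d \<longleftrightarrow> a = c \<and> b = d"
proof
  have less: "pr a b < pr c d" if "a + b < c + d" for a b c d
  proof -
    have "pr a b < (a + b + 1) * (a + b + 1)"
      unfolding pr_def by (simp add: algebra_simps)
    also have "\<dots> \<le> (c + d) * (c + d)"
      using that by (intro mult_le_mono) auto
    finally show ?thesis unfolding pr_def by simp
  qed
  assume eq: "pr a b = pr c d"
  then have "a + b = c + d"
    using less[of a b c d] less[of c d a b] by (metis less_irrefl linorder_neqE_nat)
  with eq show "a = c \<and> b = d" unfolding pr_def by simp
qed simp

text \<open>Since \<open>pr\<close> is injective, one real can carry countably many prescribed sets;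
  its values off the range of \<open>pr\<close> are immaterial.\<close>

lemma exists_columns:
  obtains W :: cantor where "\<And>j q. W (pr j q) = F j q"
proof
  have "inj (\<lambda>(j, q). pr j q)" by (auto simp: inj_def)
  then show "(\<lambda>p. case inv (\<lambda>(j, q). pr j q) p of (j, q) \<Rightarrow> F j q) (pr j q) = F j q" for j q
    using inv_f_f[of "\<lambda>(j, q). pr j q" "(j, q)"] by simp
qed

text \<open>Column 1 of \<open>W\<close> is a candidate for \<open>c\<close>, and column \<open>k + 2\<close> may refute its value at
  \<open>k\<close>. Countable choice supplies all columns at once when the candidate is right.\<close>

lemma pi11_relative:
  assumes "c \<le>\<^sub>h y" and G: "arithmetical (\<lambda>e X. G (e 0) (X 0) (X 1) (X 2))"
  obtains P where "pi11_pairs P" "{n. (n, y) \<in> P} = {n. \<forall>w. G n w c y}"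
proof -
  obtain P1 P0 where P: "pi11_pairs P1" "pi11_pairs P0"
    and Pc: "{n. c n} = {n. (n, y) \<in> P1}" "- {n. c n} = {n. (n, y) \<in> P0}"
    using assms(1) unfolding hyp_le_def by blast
  obtain S1 where S1: "arithmetical (\<lambda>e X. S1 (e 0) (X 0) (X 1))"
    and P1: "P1 = {(n, x). \<forall>w. S1 n w x}"
    using pi11_pairsE[OF P(1)] .
  obtain S0 where S0: "arithmetical (\<lambda>e X. S0 (e 0) (X 0) (X 1))"
    and P0: "P0 = {(n, x). \<forall>w. S0 n w x}"
    using pi11_pairsE[OF P(2)] .
  have c1: "c n \<longleftrightarrow> (\<forall>w. S1 n w y)" and c0: "\<not> c n \<longleftrightarrow> (\<forall>w. S0 n w y)" for n
    using Pc unfolding P1 P0 by (auto simp: set_eq_iff)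
  define T where "T n W x \<longleftrightarrow>
    (\<exists>k. W (pr 1 k) \<and> S0 k (\<lambda>q. W (pr (Suc (Suc k)) q)) x \<or>
       \<not> W (pr 1 k) \<and> S1 k (\<lambda>q. W (pr (Suc (Suc k)) q)) x) \<or>
    G n (\<lambda>q. W (pr 0 q)) (\<lambda>q. W (pr 1 q)) x" for n W x
  have "arithmetical (\<lambda>e X. T (e 0) (X 0) (X 1))"
    unfolding T_def
    by (intro arithmetical_intros numfun_pr
        arithmetical_subst[OF G, where ?h2.0 = "\<lambda>q e. q"]
        arithmetical_subst[of "\<lambda>n w x _. S0 n w x", OF S0, where ?h1.0 = "\<lambda>q e. q"
          and ?h2.0 = "\<lambda>q e. q"]
        arithmetical_subst[of "\<lambda>n w x _. S1 n w x", OF S1, where ?h1.0 = "\<lambda>q e. q"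
          and ?h2.0 = "\<lambda>q e. q"])
  then have "pi11_pairs {(n, x). \<forall>W. T n W x}" by (rule pi11_pairsI)
  moreover have "(\<forall>W. T n W y) \<longleftrightarrow> (\<forall>w. G n w c y)" for n
  proof
    assume T: "\<forall>W. T n W y"
    show "\<forall>w. G n w c y"
    proof
      fix w
      have "\<exists>u. (c k \<longrightarrow> \<not> S0 k u y) \<and> (\<not> c k \<longrightarrow> \<not> S1 k u y)" for k
        using c0[of k] c1[of k] by blast
      then obtain U where U: "\<And>k. (c k \<longrightarrow> \<not> S0 k (U k) y) \<and> (\<not> c k \<longrightarrow> \<not> S1 k (U k) y)"
        by metis
      obtain W :: cantor where W: "\<And>j q. W (pr j q) = case_nat w (case_nat c U) j q"
        using exists_columns[of "case_nat w (case_nat c U)"] by blast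
      have "T n W y" using T by blast
      then have "(\<exists>k. c k \<and> S0 k (U k) y \<or> \<not> c k \<and> S1 k (U k) y) \<or> G n w c y"
        unfolding T_def W by simp
      then show "G n w c y"
        using U by blast
    qed
  next
    assume G: "\<forall>w. G n w c y"
    show "\<forall>W. T n W y"
    proof
      fix W
      show "T n W y"
      proof (cases "(\<lambda>q. W (pr 1 q)) = c")
        case True
        then show ?thesis using G unfolding T_def by simp
      next
        \<comment> \<open>At a wrong guess for \<open>k\<close>, the relevant one of
          \<open>S0 k\<close> and \<open>S1 k\<close> holds of every set at \<open>y\<close>, so the
          refutation succeeds whatever column \<open>k + 2\<close> contains.\<close>
        case False
        then obtain k where "W (pr 1 k) \<noteq> c k" by blast
        then show ?thesis using c0[of k] c1[of k] unfolding T_def by blast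
      qed
    qed
  qed
  ultimately show ?thesis by (intro that) auto
qed

section \<open>Criteria for hyperarithmetic reducibility\<close>

lemma hyp_leI_arithmetical:
  assumes "arithmetical (\<lambda>e X. G (e 0) (X 1))" "\<And>n. x n \<longleftrightarrow> G n y"
  shows "x \<le>\<^sub>h y"
proof -
  have "pi11_pairs {(n, x). \<forall>w::cantor. G n x}" "pi11_pairs {(n, x). \<forall>w::cantor. \<not> G n x}"
    using pi11_pairsI[of "\<lambda>n w x. G n x", OF assms(1)]
      pi11_pairsI[of "\<lambda>n w x. \<not> G n x", OF arithmetical_not[OF assms(1)]] .
  moreover have "{n. x n} = {n. (n, y) \<in> {(n, x). \<forall>w::cantor. G n x}}"
    "- {n. x n} = {n. (n, y) \<in> {(n, x). \<forall>w::cantor. \<not> G n x}}"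
    using assms(2) by auto
  ultimately show ?thesis
    unfolding hyp_le_def by blast
qed

lemma hyp_le_trans [trans]:
  assumes "x \<le>\<^sub>h c" "c \<le>\<^sub>h y"
  shows "x \<le>\<^sub>h y"
proof -
  have relativize: "\<exists>P'. pi11_pairs P' \<and> {n. (n, y) \<in> P'} = {n. (n, c) \<in> P}" if P: "pi11_pairs P" for P
  proof -
    obtain G where G: "arithmetical (\<lambda>e X. G (e 0) (X 0) (X 1))" "P = {(n, x). \<forall>w. G n w x}"
      using pi11_pairsE[OF P] .
    obtain P' where "pi11_pairs P'" "{n. (n, y) \<in> P'} = {n. \<forall>w. G n w c}"
      using pi11_relative[of c y "\<lambda>n w x _. G n w x", OF assms(2) G(1)] .
    then show ?thesis using G(2) by auto
  qed
  from assms(1) obtain P R where "pi11_pairs P" "pi11_pairs R"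
    "{n. x n} = {n. (n, c) \<in> P}" "- {n. x n} = {n. (n, c) \<in> R}"
    unfolding hyp_le_def by blast
  with relativize[of P] relativize[of R] show ?thesis
    unfolding hyp_le_def by metis
qed

text \<open>As solutions exist and share column 0, "every solution has \<open>n\<close> in column 0"
  and "every solution omits \<open>n\<close> from column 0" are complementary \<Pi>11 conditions.
  The other columns may hold auxiliary data and need not be unique.\<close>

lemma hyp_le_implicit:
  assumes "c \<le>\<^sub>h y" and R: "arithmetical (\<lambda>e X. R (X 0) (X 1) (X 2))"
    and ex: "R W c y" and unique: "\<And>V n. R V c y \<Longrightarrow> V (pr 0 n) \<longleftrightarrow> z n"
  shows "z \<le>\<^sub>h y"
proof -
  have "arithmetical (\<lambda>e X. R (X 0) (X 1) (X 2) \<longrightarrow> X 0 (pr 0 (e 0)))"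
    by (intro arithmetical_intros numfun_pr R)
  then obtain P where P: "pi11_pairs P" "{n. (n, y) \<in> P} = {n. \<forall>V. R V c y \<longrightarrow> V (pr 0 n)}"
    by (rule pi11_relative[of c y "\<lambda>n w c y. R w c y \<longrightarrow> w (pr 0 n)", OF assms(1)])
  have "arithmetical (\<lambda>e X. R (X 0) (X 1) (X 2) \<longrightarrow> \<not> X 0 (pr 0 (e 0)))"
    by (intro arithmetical_intros numfun_pr R)
  then obtain P' where "pi11_pairs P'" "{n. (n, y) \<in> P'} = {n. \<forall>V. R V c y \<longrightarrow> \<not> V (pr 0 n)}"
    by (rule pi11_relative[of c y "\<lambda>n w c y. R w c y \<longrightarrow> \<not> w (pr 0 n)", OF assms(1)])
  moreover have "(\<forall>V. R V c y \<longrightarrow> V (pr 0 n)) \<longleftrightarrow> z n" "(\<forall>V. R V c y \<longrightarrow> \<not> V (pr 0 n)) \<longleftrightarrow> \<not> z n" for n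
    using ex unique by blast+
  ultimately show ?thesis
    unfolding hyp_le_def using P by (intro exI[of _ P] exI[of _ P']) auto
qed



section \<open>Sparse strings and closed null sets\<close>

definition zero_block :: "cantor \<Rightarrow> nat \<Rightarrow> bool" where
  "zero_block x j \<longleftrightarrow> (\<forall>i. j * j \<le> i \<and> i < Suc j * Suc j \<longrightarrow> \<not> x i)"

lemma cylinder_measure:
  assumes "finite J"
  shows "{x. \<forall>i\<in>J. x i = b i} \<in> sets coin_measure"
    and "emeasure coin_measure {x. \<forall>i\<in>J. x i = b i} = ennreal ((1/2) ^ card J)"
proof -
  define M where "M = (\<lambda>_::nat. measure_pmf (bernoulli_pmf (1/2)))"
  have cyl: "{x. \<forall>i\<in>J. x i = b i} = prod_emb UNIV M J (Pi\<^sub>E J (\<lambda>i. {b i}))"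
    by (auto simp: prod_emb_def M_def space_PiM PiE_def Pi_def)
  show "{x. \<forall>i\<in>J. x i = b i} \<in> sets coin_measure"
    unfolding cyl coin_measure_def M_def using assms
    by (intro sets_PiM_I) auto
  have pmf: "pmf (bernoulli_pmf (1/2)) c = 1/2" for c
    by (cases c) simp_all
  have "emeasure coin_measure {x. \<forall>i\<in>J. x i = b i} = (\<Prod>i\<in>J. emeasure (M i) {b i})"
    unfolding cyl coin_measure_def M_def using assms
    by (intro emeasure_PiM_emb) (auto intro: prob_space_measure_pmf)
  also have "\<dots> = (\<Prod>i\<in>J. ennreal (1/2))"
    by (simp add: M_def emeasure_pmf_single pmf)
  also have "\<dots> = ennreal ((1/2) ^ card J)"
    unfolding prod_constant by (rule ennreal_power) simp
  finally show "emeasure coin_measure {x. \<forall>i\<in>J. x i = b i} = ennreal ((1/2) ^ card J)" .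
qed

text \<open>Block \<open>j\<close> has length \<open>2j + 1\<close>, so the sequences having some zero block make up at most
  \<open>1/2 + 1/8 + 1/32 + \<dots> = 2/3\<close> of the cylinder.\<close>

lemma mu_null_avoid_zero_blocks:
  assumes "mu_null A"
  shows "\<exists>x. (\<forall>i<a * a. x i = f i) \<and> (\<forall>j\<ge>a. \<not> zero_block x j) \<and> x \<notin> A"
proof (rule ccontr)
  assume contra: "\<nexists>x. (\<forall>i<a * a. x i = f i) \<and> (\<forall>j\<ge>a. \<not> zero_block x j) \<and> x \<notin> A"
  \<comment> \<open>Nullness refers to the completion, so \<open>A\<close> is replaced by a
    measurable null cover.\<close>
  obtain N where N: "N \<in> null_sets coin_measure" "A \<subseteq> N"
    using assms unfolding mu_null_def null_sets_completion_iff2 by blast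
  define r :: real where "r = (1/2) ^ (a * a)"
  define U where "U = {x. \<forall>i\<in>{..<a * a}. x i = f i}"
  define J where "J k = {..<a * a} \<union> {(a + k) * (a + k)..<Suc (a + k) * Suc (a + k)}" for k
  \<comment> \<open>The cylinder of \<open>f\<close> with block \<open>a + k\<close> zero: the
    conjunct \<open>i < a * a\<close> prescribes False on that block.\<close>
  define Z where "Z k = {x. \<forall>i\<in>J k. x i = (i < a * a \<and> f i)}" for k
  have U: "emeasure coin_measure U = ennreal r"
    unfolding U_def r_def by (subst cylinder_measure) simp_all
  have Zset: "Z k \<in> sets coin_measure" for k
    unfolding Z_def J_def by (rule cylinder_measure) simp
  have Z: "emeasure coin_measure (Z k) \<le> ennreal (r * (1/2) * (1/4) ^ k)" for k
  proof -
    have "card (J k) = a * a + (2 * (a + k) + 1)"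
      unfolding J_def by (subst card_Un_disjoint) (auto simp: algebra_simps)
    then have "emeasure coin_measure (Z k) = ennreal ((1/2) ^ (a * a + (2 * (a + k) + 1)))"
      unfolding Z_def by (subst cylinder_measure) (simp_all add: J_def)
    \<comment> \<open>Dropping \<open>2 * a\<close> from the exponent leaves a geometric series of
      ratio 1/4.\<close>
    also have "\<dots> \<le> ennreal ((1/2) ^ (a * a + 1 + 2 * k))"
      by (intro ennreal_leI power_decreasing) auto
    also have "(1/2::real) ^ (a * a + 1 + 2 * k) = r * (1/2) * (1/4) ^ k"
      by (simp add: r_def power_add power_mult power2_eq_square)
    finally show ?thesis .
  qed
  have "U \<subseteq> N \<union> (\<Union>k. Z k)"
  proof
    fix x assume x: "x \<in> U"
    show "x \<in> N \<union> (\<Union>k. Z k)"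
    proof (cases "x \<in> A")
      case False
      then obtain j where j: "j \<ge> a" "zero_block x j"
        using contra x unfolding U_def by auto
      have "a * a \<le> j * j" using j by (intro mult_le_mono) auto
      then have "x \<in> Z (j - a)"
        using x j unfolding U_def Z_def J_def zero_block_def by auto
      then show ?thesis by blast
    qed (use N in blast)
  qed
  then have "ennreal r \<le> emeasure coin_measure (N \<union> (\<Union>k. Z k))"
    unfolding U[symmetric] using N Zset by (intro emeasure_mono) auto
  also have "\<dots> \<le> emeasure coin_measure N + emeasure coin_measure (\<Union>k. Z k)"
    using N Zset by (intro emeasure_subadditive) auto
  also have "\<dots> \<le> (\<Sum>k. emeasure coin_measure (Z k))"
    using N Zset by (simp add: null_setsD1) (intro emeasure_subadditive_countably, auto)
  also have "\<dots> \<le> (\<Sum>k. ennreal (r * (1/2) * (1/4) ^ k))"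
    by (intro suminf_le Z) auto
  also have "\<dots> = ennreal (r * (1/2) * (4/3))"
  proof (intro suminf_ennreal_eq sums_mult)
    show "(\<lambda>k. (1/4) ^ k) sums (4/3 :: real)"
      using geometric_sums[of "1/4 :: real"] by simp
  qed (simp add: r_def)
  finally have "r \<le> r * (1/2) * (4/3)"
    by (subst (asm) ennreal_le_iff) (simp_all add: r_def)
  moreover have "r > 0" by (simp add: r_def)
  ultimately show False by simp
qed

text \<open>A basic open neighbourhood in the product topology restricts only finitely many
  coordinates.\<close>

lemma closed_avoid_prefix:
  fixes A :: "cantor set"
  assumes "closed A" "x \<notin> A"
  obtains m where "\<And>y. (\<And>i. i < m \<Longrightarrow> y i = x i) \<Longrightarrow> y \<notin> A"
proof -
  have "openin (product_topology (\<lambda>i. euclidean) UNIV) (- A)"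
    using assms(1) unfolding closed_def open_fun_def .
  from product_topology_open_contains_basis[OF this, of x] assms(2)
  have "\<exists>X. x \<in> (\<Pi>\<^sub>E i\<in>UNIV. X i) \<and> (\<forall>i. open (X i)) \<and> finite {i. X i \<noteq> UNIV} \<and>
      (\<Pi>\<^sub>E i\<in>UNIV. X i) \<subseteq> - A"
    by simp
  then obtain X where X: "x \<in> (\<Pi>\<^sub>E i\<in>UNIV. X i)" "finite {i. X i \<noteq> UNIV}"
    "(\<Pi>\<^sub>E i\<in>UNIV. X i) \<subseteq> - A"
    by blast
  obtain m where m: "\<And>i. X i \<noteq> UNIV \<Longrightarrow> i < m"
    using finite_nat_set_iff_bounded X(2) by auto
  show ?thesis
  proof (rule that)
    fix y assume y: "\<And>i. i < m \<Longrightarrow> y i = x i"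
    have "y i \<in> X i" for i
      using X(1) m[of i] y[of i] by (cases "X i = UNIV") auto
    then show "y \<notin> A" using X(3) by auto
  qed
qed


section \<open>String codes\<close>

text \<open>Only the empty string has code 0, and the parity of a positive code reveals the first
  bit.\<close>

lemma string_code_inj: "string_code \<sigma> = string_code \<tau> \<Longrightarrow> \<sigma> = \<tau>"
proof (induction \<sigma> arbitrary: \<tau>)
  case Nil
  then show ?case by (cases \<tau>) (auto split: if_splits)
next
  case (Cons b \<sigma>)
  show ?case
  proof (cases \<tau>)
    case Nil
    then show ?thesis using Cons.prems by (auto split: if_splits)
  next
    case (Cons d \<rho>)
    then have eq: "2 * string_code \<sigma> + (if b then 2 else 1) = 2 * string_code \<rho> + (if d then 2 else 1)"
      using Cons.prems by simp
    then have "b = d" by (cases b; cases d) (simp_all, presburger+)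
    with eq Cons Cons.IH show ?thesis by simp
  qed
qed

lemma string_code_surj: "\<exists>\<sigma>. string_code \<sigma> = s"
proof (induction s rule: less_induct)
  case (less s)
  have "s = 0 \<or> (\<exists>t. s = 2 * t + 1) \<or> (\<exists>t. s = 2 * t + 2)" by presburger
  then consider "s = 0" | t where "s = 2 * t + 1" | t where "s = 2 * t + 2" by blast
  then show ?case
  proof cases
    case 1
    then show ?thesis by (intro exI[of _ "[]"]) simp
  next
    case 2
    then obtain \<sigma> where "string_code \<sigma> = t" using less[of t] by auto
    then show ?thesis using 2 by (intro exI[of _ "False # \<sigma>"]) simp
  next
    case 3
    then obtain \<sigma> where "string_code \<sigma> = t" using less[of t] by auto
    then show ?thesis using 3 by (intro exI[of _ "True # \<sigma>"]) simp
  qed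
qed

text \<open>\<open>L s i\<close> says that the string coded by \<open>s\<close> has a bit number \<open>i\<close>, and \<open>B s i\<close> that this bit
  is true. These recursive clauses let an arithmetical formula decode strings from two guessed
  tables, without defining exponentiation.\<close>

definition tables :: "(nat \<Rightarrow> nat \<Rightarrow> bool) \<Rightarrow> (nat \<Rightarrow> nat \<Rightarrow> bool) \<Rightarrow> bool" where
  "tables L B \<longleftrightarrow> (\<forall>i. \<not> L 0 i \<and> \<not> B 0 i) \<and>
    (\<forall>t. L (Suc (t + t)) 0 \<and> \<not> B (Suc (t + t)) 0 \<and>
      L (Suc (Suc (t + t))) 0 \<and> B (Suc (Suc (t + t))) 0 \<and>
      (\<forall>i. (L (Suc (t + t)) (Suc i) \<longleftrightarrow> L t i) \<and> (B (Suc (t + t)) (Suc i) \<longleftrightarrow> B t i) \<and>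
        (L (Suc (Suc (t + t))) (Suc i) \<longleftrightarrow> L t i) \<and> (B (Suc (Suc (t + t))) (Suc i) \<longleftrightarrow> B t i)))"

definition has_bit :: "nat \<Rightarrow> nat \<Rightarrow> bool" where
  "has_bit s i \<longleftrightarrow> i < length (inv string_code s)"

definition true_bit :: "nat \<Rightarrow> nat \<Rightarrow> bool" where
  "true_bit s i \<longleftrightarrow> has_bit s i \<and> inv string_code s ! i"

lemma inv_string_code [simp]: "inv string_code (string_code \<sigma>) = \<sigma>"
  by (rule inv_f_f) (auto intro: injI string_code_inj)

lemma string_code_inv [simp]: "string_code (inv string_code s) = s"
  by (metis inv_string_code string_code_surj)

lemma inv_string_code_Suc:
  "inv string_code 0 = []"
  "inv string_code (Suc (t + t)) = False # inv string_code t"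
  "inv string_code (Suc (Suc (t + t))) = True # inv string_code t"
  by (rule string_code_inj; simp)+

lemma tables_bits: "tables has_bit true_bit"
  unfolding tables_def has_bit_def true_bit_def by (simp add: inv_string_code_Suc)

text \<open>The clauses determine both tables by recursion on the coded string, so a formula that
  guesses tables can only guess the true ones.\<close>

lemma tables_unique:
  assumes "tables L B"
  shows "L = has_bit" "B = true_bit"
proof -
  have code: "string_code (b # \<sigma>) = (if b then Suc (Suc (string_code \<sigma> + string_code \<sigma>))
    else Suc (string_code \<sigma> + string_code \<sigma>))" for b \<sigma>
    by simp
  have *: "(L (string_code \<sigma>) i \<longleftrightarrow> has_bit (string_code \<sigma>) i) \<and>
      (B (string_code \<sigma>) i \<longleftrightarrow> true_bit (string_code \<sigma>) i)" for \<sigma> i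
  proof (induction \<sigma> arbitrary: i)
    case Nil
    then show ?case using assms tables_bits unfolding tables_def by simp
  next
    case (Cons b \<sigma>)
    then show ?case using assms tables_bits unfolding tables_def code
      by (cases i; cases b) simp_all
  qed
  have "L s i \<longleftrightarrow> has_bit s i" "B s i \<longleftrightarrow> true_bit s i" for s i
    using *[of "inv string_code s" i] by simp_all
  then show "L = has_bit" "B = true_bit" by (simp_all add: fun_eq_iff)
qed

lemma real_of_pairs_iff: "real_of_pairs C (prod_encode (n, string_code \<sigma>)) \<longleftrightarrow> (n, \<sigma>) \<in> C"
  unfolding real_of_pairs_def by (auto dest: string_code_inj)


section \<open>The coding construction\<close>

text \<open>\<open>candidate n a f s b\<close>: \<open>s\<close> codes a string of length \<open>b\<^sup>2\<close> that extends \<open>f\<close> below \<open>a\<^sup>2\<close>,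
  has no zero block from \<open>a\<close> on, and leaves the \<open>n\<close>-th tree. The clause about \<open>p\<close> says
  \<open>\<not> c (prod_encode (n, s))\<close> without division.\<close>

definition candidate ::
  "(nat \<Rightarrow> nat \<Rightarrow> bool) \<Rightarrow> (nat \<Rightarrow> nat \<Rightarrow> bool) \<Rightarrow> cantor \<Rightarrow> nat \<Rightarrow> nat \<Rightarrow> cantor \<Rightarrow> nat \<Rightarrow> nat \<Rightarrow> bool"
  where
  "candidate L B c n a f s b \<longleftrightarrow> a \<le> b \<and> (\<forall>i. L s i \<longleftrightarrow> i < b * b) \<and>
    (\<forall>i. i < a * a \<longrightarrow> (B s i \<longleftrightarrow> f i)) \<and>
    (\<forall>j. a \<le> j \<and> j < b \<longrightarrow> (\<exists>i. j * j \<le> i \<and> i < Suc j * Suc j \<and> B s i)) \<and>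
    \<not> (\<exists>p. p + p = (n + s) * Suc (n + s) + (n + n) \<and> c p)"

text \<open>Before the stage \<open>a\<close> blocks are settled, after the extension
  \<open>b\<close>. The least code is taken among candidates of all lengths; without a candidate
  nothing is appended. The remaining clause fills with ones and writes the coding block
  \<open>pr n b\<close>.\<close>

definition stage ::
  "(nat \<Rightarrow> nat \<Rightarrow> bool) \<Rightarrow> (nat \<Rightarrow> nat \<Rightarrow> bool) \<Rightarrow> cantor \<Rightarrow> cantor \<Rightarrow> nat \<Rightarrow> nat \<Rightarrow> nat \<Rightarrow> cantor \<Rightarrow> bool"
  where
  "stage L B c y n a b f \<longleftrightarrow>
    ((\<exists>s. candidate L B c n a f s b \<and> (\<forall>t. t < s \<longrightarrow> \<not> (\<exists>d. candidate L B c n a f t d)) \<and>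
        (\<forall>i. i < b * b \<longrightarrow> (f i \<longleftrightarrow> B s i))) \<or>
      \<not> (\<exists>s d. candidate L B c n a f s d) \<and> b = a) \<and>
    (\<forall>i. b * b \<le> i \<and> i < Suc (pr n b) * Suc (pr n b) \<longrightarrow>
      (f i \<longleftrightarrow> i < pr n b * pr n b \<or> \<not> y n))"

text \<open>The count of settled blocks is a relation, not a function, so that it fits into a column
  of a real; it need not be single-valued for \<open>z\<close> to be determined.\<close>

definition run ::
  "(nat \<Rightarrow> nat \<Rightarrow> bool) \<Rightarrow> (nat \<Rightarrow> nat \<Rightarrow> bool) \<Rightarrow> (nat \<Rightarrow> nat \<Rightarrow> bool) \<Rightarrow> cantor \<Rightarrow> cantor \<Rightarrow> cantor \<Rightarrow> bool"
  where
  "run L B A z c y \<longleftrightarrow> tables L B \<and> A 0 0 \<and>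
    (\<forall>n a. A n a \<longrightarrow> (\<exists>b. stage L B c y n a b z \<and> A (Suc n) (Suc (pr n b))))"

lemma arithmetical_run:
  "arithmetical (\<lambda>e X. run (\<lambda>s i. X 0 (pr 1 (pr s i))) (\<lambda>s i. X 0 (pr 2 (pr s i)))
    (\<lambda>n a. X 0 (pr 3 (pr n a))) (\<lambda>i. X 0 (pr 0 i)) (X 1) (X 2))"
  unfolding run_def stage_def tables_def candidate_def
  by (intro arithmetical_intros numfun_pr)

text \<open>This places the coding block of a stage after the blocks of its extension.\<close>

lemma le_pr: "b \<le> pr n b"
  unfolding pr_def by (cases "n + b") (auto simp: algebra_simps)

section \<open>Locality, determinism and existence of a single stage\<close>

lemma candidate_cong:
  assumes "\<And>i. i < a * a \<Longrightarrow> f i = g i"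
  shows "candidate L B c n a f s b \<longleftrightarrow> candidate L B c n a g s b"
  using assms unfolding candidate_def by auto

lemma candidate_length_unique:
  assumes "candidate L B c n a f s b" "candidate L B c n a g s d"
  shows "b = d"
proof -
  have "i < b * b \<longleftrightarrow> i < d * d" for i
    using assms unfolding candidate_def by blast
  then have "b * b = d * d" by (metis less_irrefl linorder_neqE_nat)
  then show ?thesis by (metis power2_eq_square power2_eq_iff_nonneg zero_le)
qed

lemma stage_le: "stage L B c y n a b f \<Longrightarrow> a \<le> b"
  unfolding stage_def candidate_def by blast

text \<open>A stage inspects \<open>f\<close> only up to the end of its coding block, so it passes
  from finite approximations to the limit.\<close>

lemma stage_cong:
  assumes st: "stage L B c y n a b f"
    and eq: "\<And>i. i < Suc (pr n b) * Suc (pr n b) \<Longrightarrow> f i = g i"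
  shows "stage L B c y n a b g"
proof -
  have b: "b * b \<le> Suc (pr n b) * Suc (pr n b)"
    using le_pr[of b n] by (intro mult_le_mono) auto
  have "a * a \<le> b * b" using stage_le[OF st] by (intro mult_le_mono)
  then have "candidate L B c n a g = candidate L B c n a f"
    using b eq by (intro ext candidate_cong) auto
  moreover have "(\<forall>i. i < b * b \<longrightarrow> (g i \<longleftrightarrow> B s i)) \<longleftrightarrow> (\<forall>i. i < b * b \<longrightarrow> (f i \<longleftrightarrow> B s i))" for s
    using b eq by auto
  ultimately show ?thesis
    using st eq unfolding stage_def by auto
qed

text \<open>The least candidate is unique and its code fixes its length; everything after it is
  prescribed by \<open>n\<close>, \<open>b\<close> and \<open>y\<close>.\<close>

lemma stage_unique:
  assumes st: "stage L B c y n a b f" "stage L B c y n a d g"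
    and eq: "\<And>i. i < a * a \<Longrightarrow> f i = g i"
  shows "b = d" and "\<And>i. i < Suc (pr n b) * Suc (pr n b) \<Longrightarrow> f i = g i"
proof -
  have cand: "candidate L B c n a f = candidate L B c n a g"
    using eq by (intro ext candidate_cong) auto
  have *: "b = d \<and> (\<forall>i<b * b. f i = g i)"
  proof (cases "\<exists>s d. candidate L B c n a g s d")
    case True
    then obtain s t where
      s: "candidate L B c n a g s b" "\<And>t. t < s \<Longrightarrow> \<not> (\<exists>d. candidate L B c n a g t d)"
        "\<And>i. i < b * b \<Longrightarrow> f i = B s i" and
      t: "candidate L B c n a g t d" "\<And>s. s < t \<Longrightarrow> \<not> (\<exists>d. candidate L B c n a g s d)"
        "\<And>i. i < d * d \<Longrightarrow> g i = B t i"
      using st unfolding stage_def cand by metis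
    have "s = t" using s(1,2) t(1,2) by (metis linorder_neqE_nat)
    moreover from this have "b = d" using candidate_length_unique s(1) t(1) by metis
    ultimately show ?thesis using s(3) t(3) by simp
  next
    case False
    then have "b = a" "d = a" using st unfolding stage_def cand by blast+
    then show ?thesis using eq by simp
  qed
  then show "b = d" by simp
  fix i assume i: "i < Suc (pr n b) * Suc (pr n b)"
  show "f i = g i"
  proof (cases "i < b * b")
    case False
    then show ?thesis using st i * unfolding stage_def by auto
  qed (use * in simp)
qed

lemma stage_exists: "\<exists>b f. stage L B c y n a b f \<and> (\<forall>i<a * a. f i = g i)"
proof (cases "\<exists>s d. candidate L B c n a g s d")
  case True
  define s where "s = (LEAST s. \<exists>d. candidate L B c n a g s d)"
  from True have "\<exists>d. candidate L B c n a g s d"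
    unfolding s_def by (rule LeastI_ex)
  then obtain b where b: "candidate L B c n a g s b" ..
  have least: "\<not> (\<exists>d. candidate L B c n a g t d)" if "t < s" for t
    using not_less_Least that unfolding s_def by blast
  define f where "f i \<longleftrightarrow> (if i < b * b then B s i else i < pr n b * pr n b \<or> \<not> y n)" for i
  have "a * a \<le> b * b" using b unfolding candidate_def by (intro mult_le_mono) auto
  then have eq: "f i = g i" if "i < a * a" for i
    using b that unfolding candidate_def f_def by auto
  have "candidate L B c n a f = candidate L B c n a g"
    using eq by (intro ext candidate_cong)
  then have "stage L B c y n a b f"
    unfolding stage_def using b least by (auto simp: f_def)
  then show ?thesis using eq by blast
next
  case False
  define f where "f i \<longleftrightarrow> (if i < a * a then g i else i < pr n a * pr n a \<or> \<not> y n)" for i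
  have "candidate L B c n a f = candidate L B c n a g"
    by (intro ext candidate_cong) (simp add: f_def)
  then have "stage L B c y n a a f"
    unfolding stage_def using False by (auto simp: f_def)
  then show ?thesis by (intro exI[of _ a] exI[of _ f]) (simp add: f_def)
qed

text \<open>\<open>A n\<close> is the number of blocks of \<open>z\<close> settled before stage \<open>n\<close>.\<close>

definition coding :: "cantor \<Rightarrow> cantor \<Rightarrow> (nat \<Rightarrow> nat) \<Rightarrow> cantor \<Rightarrow> bool" where
  "coding c y A z \<longleftrightarrow> A 0 = 0 \<and>
    (\<forall>n. \<exists>b. stage has_bit true_bit c y n (A n) b z \<and> A (Suc n) = Suc (pr n b))"

section \<open>The infinite construction, its uniqueness and the decoding of
  \<open>y\<close>\<close>

lemma codingE:
  assumes "coding c y A z"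
  obtains b where "stage has_bit true_bit c y n (A n) b z" "A (Suc n) = Suc (pr n b)"
  using assms unfolding coding_def by blast

lemma coding_ge:
  assumes "coding c y A z"
  shows "n \<le> A n"
proof (induction n)
  case (Suc n)
  obtain b where "stage has_bit true_bit c y n (A n) b z" "A (Suc n) = Suc (pr n b)"
    using codingE[OF assms] .
  then show ?case using Suc stage_le le_pr by (metis Suc_le_mono le_trans)
qed simp

lemma coding_exists: "\<exists>A z. coding c y A z"
proof -
  define P where "P n x \<longleftrightarrow> (n = 0 \<longrightarrow> fst x = 0)" for n :: nat and x :: "nat \<times> cantor"
  define Q where "Q n x x' \<longleftrightarrow> (\<exists>b. stage has_bit true_bit c y n (fst x) b (snd x') \<and> fst x' = Suc (pr n b)) \<and>
    (\<forall>i<fst x * fst x. snd x' i = snd x i)" for n and x x' :: "nat \<times> cantor"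
  have "\<exists>F. \<forall>n. P n (F n) \<and> Q n (F n) (F (Suc n))"
  proof (rule dependent_nat_choice)
    show "\<exists>x. P 0 x" by (simp add: P_def)
    fix x n
    obtain b f where "stage has_bit true_bit c y n (fst x) b f" "\<forall>i<fst x * fst x. f i = snd x i"
      using stage_exists[of has_bit true_bit c y n "fst x" "snd x"] by blast
    then have "P (Suc n) (Suc (pr n b), f)" "Q n x (Suc (pr n b), f)"
      by (auto simp: P_def Q_def)
    then show "\<exists>x'. P (Suc n) x' \<and> Q n x x'" by blast
  qed
  then obtain F where F: "\<And>n. P n (F n)" "\<And>n. Q n (F n) (F (Suc n))" by blast
  define A where "A n = fst (F n)" for n
  define f where "f n = snd (F n)" for n
  have step: "\<exists>b. stage has_bit true_bit c y n (A n) b (f (Suc n)) \<and> A (Suc n) = Suc (pr n b)" for n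
    using F(2)[of n] by (auto simp: Q_def A_def f_def)
  have agree_Suc: "f (Suc n) i = f n i" if "i < A n * A n" for n i
    using F(2)[of n] that by (auto simp: Q_def A_def f_def)
  have "A n < A (Suc n)" for n
    using step[of n] stage_le le_pr by (metis le_imp_less_Suc le_trans)
  then have mono: "strict_mono A" by (simp add: strict_mono_Suc_iff)
  have agree: "f m i = f n i" if "n \<le> m" "i < A n * A n" for m n i
    using that
  proof (induction m rule: dec_induct)
    case (step m)
    have "A n * A n \<le> A m * A m"
      using step strict_mono_less_eq[OF mono] by (intro mult_le_mono) auto
    then show ?case using step agree_Suc[of i m] by auto
  qed simp
  \<comment> \<open>Each stage settles at least one block, so position \<open>i\<close> is final
    after stage \<open>i\<close>.\<close>
  define z where "z i = f (Suc i) i" for i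
  have z: "f n i = z i" if "i < A n * A n" for n i
  proof (cases "n \<le> Suc i")
    case False
    have "Suc i \<le> A (Suc i)" using mono by (rule strict_mono_imp_increasing)
    then have "Suc i * 1 \<le> A (Suc i) * A (Suc i)" by (intro mult_le_mono) auto
    then have "i < A (Suc i) * A (Suc i)" by simp
    then show ?thesis using agree[of "Suc i" n i] False unfolding z_def by simp
  qed (use agree that in \<open>simp add: z_def\<close>)
  have "A 0 = 0" using F(1)[of 0] by (simp add: P_def A_def)
  moreover have "\<exists>b. stage has_bit true_bit c y n (A n) b z \<and> A (Suc n) = Suc (pr n b)" for n
    using step[of n] z[of _ "Suc n"] stage_cong by metis
  ultimately show ?thesis unfolding coding_def by blast
qed

text \<open>By induction on \<open>n\<close>, the guessed relation contains the true count
  \<open>A n\<close> and the two reals agree below \<open>A n * A n\<close>; determinism of stages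
  carries this on.\<close>

lemma run_unique:
  assumes A: "coding c y A z"
    and run: "run L B R w c y"
  shows "w = z"
proof -
  have tab: "L = has_bit" "B = true_bit"
    using run tables_unique unfolding run_def by blast+
  have *: "R n (A n) \<and> (\<forall>i<A n * A n. w i = z i)" for n
  proof (induction n)
    case 0
    then show ?case using A run unfolding run_def coding_def by simp
  next
    case (Suc n)
    obtain b where b: "stage has_bit true_bit c y n (A n) b z" "A (Suc n) = Suc (pr n b)"
      using codingE[OF A] .
    obtain d where d: "stage has_bit true_bit c y n (A n) d w" "R (Suc n) (Suc (pr n d))"
      using run Suc unfolding run_def tab by blast
    have "w i = z i" if "i < A n * A n" for i using Suc that by simp
    from stage_unique[OF d(1) b(1) this] show ?case
      using b(2) d(2) by simp
  qed
  have "i < A (Suc i) * A (Suc i)" for i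
    using coding_ge[OF A, of "Suc i"] le_square[of "A (Suc i)"] by linarith
  then show ?thesis using * by blast
qed

text \<open>The real \<open>z\<close>, the two tables and the graph of \<open>A\<close>, stored as
  columns 0 to 3, solve the arithmetical condition \<open>run\<close>, whose solutions all have
  \<open>z\<close> in column 0.\<close>

lemma coding_hyp_le:
  assumes "c \<le>\<^sub>h y"
    and A: "coding c y A z"
  shows "z \<le>\<^sub>h y"
proof -
  define R where "R W c y \<longleftrightarrow> run (\<lambda>s i. W (pr 1 (pr s i))) (\<lambda>s i. W (pr 2 (pr s i)))
    (\<lambda>n a. W (pr 3 (pr n a))) (\<lambda>i. W (pr 0 i)) c y" for W c y
  obtain Lc where Lc: "\<And>s i. Lc (pr s i) = has_bit s i" using exists_columns[of has_bit] by blast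
  obtain Bc where Bc: "\<And>s i. Bc (pr s i) = true_bit s i" using exists_columns[of true_bit] by blast
  obtain Ac where Ac: "\<And>n a. Ac (pr n a) \<longleftrightarrow> a = A n" using exists_columns[of "\<lambda>n a. a = A n"] by blast
  obtain W where W: "\<And>j q. W (pr j q) = (case_nat z (case_nat Lc (case_nat Bc (\<lambda>_. Ac)))) j q"
    using exists_columns[of "case_nat z (case_nat Lc (case_nat Bc (\<lambda>_. Ac)))"] by blast
  have "run has_bit true_bit (\<lambda>n a. a = A n) z c y"
    unfolding run_def
  proof (intro conjI allI impI)
    show "0 = A 0" using A unfolding coding_def by simp
    show "\<exists>b. stage has_bit true_bit c y n a b z \<and> Suc (pr n b) = A (Suc n)" if "a = A n" for n a
      using codingE[OF A, of n] that by metis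
  qed (rule tables_bits)
  then have "R W c y"
    unfolding R_def W by (simp add: numeral_2_eq_2 numeral_3_eq_3 Lc Bc Ac)
  moreover have "V (pr 0 n) \<longleftrightarrow> z n" if "R V c y" for V n
    using run_unique[OF A that[unfolded R_def]] by (rule fun_cong)
  moreover have "arithmetical (\<lambda>e X. R (X 0) (X 1) (X 2))"
    unfolding R_def by (rule arithmetical_run)
  ultimately show ?thesis
    using hyp_le_implicit[OF assms(1), of R W z] by blast
qed

text \<open>A true \<open>y i\<close> leaves a zero block when stage \<open>i\<close> ends.
  Conversely, extension and filling blocks are nonzero, so a zero block is the coding block of some
  stage \<open>n\<close>, and injectivity of \<open>pr\<close> identifies \<open>n\<close> with
  \<open>i\<close>.\<close>

lemma coding_decode:
  assumes A: "coding c y A z"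
  shows "y i \<longleftrightarrow> (\<exists>k. zero_block z (pr i k))"
proof
  assume "y i"
  obtain b where b: "stage has_bit true_bit c y i (A i) b z" using codingE[OF A] .
  have "b * b \<le> pr i b * pr i b" using le_pr by (intro mult_le_mono)
  then have "zero_block z (pr i b)"
    using b \<open>y i\<close> unfolding zero_block_def stage_def by auto
  then show "\<exists>k. zero_block z (pr i k)" ..
next
  assume "\<exists>k. zero_block z (pr i k)"
  then obtain k where k: "zero_block z (pr i k)" ..
  define m where "m = pr i k"
  \<comment> \<open>The stage that settles block \<open>m\<close> is the predecessor of the least
    \<open>N\<close> with \<open>m < A N\<close>.\<close>
  define N where "N = (LEAST N. m < A N)"
  have "m < A (Suc m)" using coding_ge[OF A, of "Suc m"] by simp
  then have N: "m < A N" unfolding N_def by (rule LeastI)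
  moreover have "A 0 = 0" using A unfolding coding_def by simp
  ultimately obtain n where "N = Suc n" by (cases N) auto
  with N have n: "A n \<le> m" "m < A (Suc n)"
    using not_less_Least[of n "\<lambda>N. m < A N"] unfolding N_def by auto
  obtain b where b: "stage has_bit true_bit c y n (A n) b z" "A (Suc n) = Suc (pr n b)"
    using codingE[OF A] .
  have sq: "m * m < Suc m * Suc m" by (intro mult_strict_mono) auto
  consider "m < b" | "b \<le> m" "m < pr n b" | "m = pr n b" using n b by linarith
  then show "y i"
  proof cases
    case 1
    \<comment> \<open>Without a candidate \<open>b\<close> would equal \<open>A n\<close>; so block
      \<open>m\<close> comes from a candidate and is nonzero.\<close>
    then have "b \<noteq> A n" using n by simp
    then obtain s where s: "candidate has_bit true_bit c n (A n) z s b"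
      "\<forall>i. i < b * b \<longrightarrow> (z i \<longleftrightarrow> true_bit s i)"
      using b(1) unfolding stage_def by blast
    obtain i where i: "m * m \<le> i" "i < Suc m * Suc m" "true_bit s i"
      using s(1) 1 n(1) unfolding candidate_def by blast
    have "Suc m * Suc m \<le> b * b" using 1 by (intro mult_le_mono) auto
    then show ?thesis using k i s(2) unfolding zero_block_def m_def by auto
  next
    case 2
    have "b * b \<le> m * m" "m * m < pr n b * pr n b" "pr n b * pr n b \<le> Suc (pr n b) * Suc (pr n b)"
      using 2 by (auto intro: mult_le_mono mult_strict_mono)
    then have "z (m * m)" using b(1) unfolding stage_def by auto
    then show ?thesis using k sq unfolding zero_block_def m_def by blast
  next
    case 3
    then have "i = n" by (simp add: m_def)
    have "b * b \<le> m * m" using 3 le_pr by (simp add: mult_le_mono)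
    then have "z (m * m) \<longleftrightarrow> \<not> y n" using b(1) 3 sq unfolding stage_def by auto
    then show ?thesis using k sq \<open>i = n\<close> unfolding zero_block_def m_def by blast
  qed
qed

lemma coding_decode_hyp_le:
  assumes "\<And>i. y i \<longleftrightarrow> (\<exists>k. zero_block z (pr i k))"
  shows "y \<le>\<^sub>h z"
proof (rule hyp_leI_arithmetical)
  show "arithmetical (\<lambda>e X. \<exists>k. zero_block (X 1) (pr (e 0) k))"
    unfolding zero_block_def by (intro arithmetical_intros numfun_pr)
qed (rule assms)

section \<open>Randomness of the constructed real and the cone\<close>

lemma triangle_eq_iff: "p + p = (n + s) * Suc (n + s) + (n + n) \<longleftrightarrow> p = prod_encode (n, s)"
proof -
  have "2 * triangle (n + s) = (n + s) * Suc (n + s)"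
    unfolding triangle_def by (rule dvd_mult_div_cancel) simp
  then show ?thesis unfolding prod_encode_def by auto
qed

text \<open>Every prefix of a member of \<open>F\<close> is marked by \<open>c\<close>, whereas
  stage \<open>n\<close> puts an unmarked string into \<open>z\<close> as soon as some candidate
  exists. A candidate is a long enough prefix of a point outside \<open>F\<close> without later zero
  blocks.\<close>

lemma coding_avoids:
  assumes A: "coding c y A z"
    and c: "\<And>\<sigma>. c (prod_encode (n, string_code \<sigma>)) \<longleftrightarrow> (\<exists>x\<in>F. \<sigma> \<prec> x)"
    and F: "closed F" "mu_null F"
  shows "z \<notin> F"
proof
  assume "z \<in> F"
  obtain b where b: "stage has_bit true_bit c y n (A n) b z" using codingE[OF A] .
  define a where "a = A n"
  obtain x where x: "\<And>i. i < a * a \<Longrightarrow> x i = z i" "\<And>j. j \<ge> a \<Longrightarrow> \<not> zero_block x j" "x \<notin> F"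
    using mu_null_avoid_zero_blocks[OF F(2), of a z] by blast
  obtain m where m: "\<And>y. (\<And>i. i < m \<Longrightarrow> y i = x i) \<Longrightarrow> y \<notin> F"
    using closed_avoid_prefix[OF F(1) x(3)] by blast
  \<comment> \<open>The string must reach past the \<open>a\<close> settled blocks and past the
    \<open>m\<close> bits that force it out of \<open>F\<close>.\<close>
  define d where "d = max a m"
  have d: "a * a \<le> d * d" "m \<le> d * d"
    by (auto simp: d_def intro: mult_le_mono le_trans[OF _ le_square])
  define \<sigma> where "\<sigma> = map x [0..<d * d]"
  have bits: "has_bit (string_code \<sigma>) i \<longleftrightarrow> i < d * d"
    "true_bit (string_code \<sigma>) i \<longleftrightarrow> i < d * d \<and> x i" for i
    unfolding has_bit_def true_bit_def \<sigma>_def by auto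
  have "candidate has_bit true_bit c n a z (string_code \<sigma>) d"
    unfolding candidate_def bits
  proof (intro conjI allI impI)
    show "a \<le> d" by (simp add: d_def)
    show "i < d * d \<and> x i \<longleftrightarrow> z i" if "i < a * a" for i
      using that x(1) d by auto
    show "\<exists>i. j * j \<le> i \<and> i < Suc j * Suc j \<and> i < d * d \<and> x i" if "a \<le> j \<and> j < d" for j
    proof -
      have "Suc j * Suc j \<le> d * d" using that by (intro mult_le_mono) auto
      then show ?thesis using x(2)[of j] that unfolding zero_block_def by (meson less_le_trans)
    qed
    have "\<not> \<sigma> \<prec> w" if "w \<in> F" for w
      using m[of w] that d unfolding initial_segment_def \<sigma>_def by fastforce
    then show "\<not> (\<exists>p. p + p = (n + string_code \<sigma>) * Suc (n + string_code \<sigma>) + (n + n) \<and> c p)"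
      unfolding triangle_eq_iff using c by auto
  qed simp
  \<comment> \<open>Existence of a candidate excludes the alternative of \<open>stage\<close> that
    appends nothing.\<close>
  then obtain s where s: "candidate has_bit true_bit c n a z s b"
    "\<And>i. i < b * b \<Longrightarrow> z i \<longleftrightarrow> true_bit s i"
    using b unfolding stage_def a_def by blast
  have "\<not> c (prod_encode (n, s))"
    using s(1) unfolding candidate_def triangle_eq_iff by blast
  moreover have "inv string_code s \<prec> z"
    using s unfolding candidate_def initial_segment_def true_bit_def has_bit_def by auto
  ultimately show False
    using c[of "inv string_code s"] \<open>z \<in> F\<close> by auto
qed

text \<open>Universality presents each closed null \<Pi>11 set as a null slice \<open>n\<close>, for
  which \<open>c\<close> marks exactly the prefixes of its members; stage \<open>n\<close> then
  leaves it.\<close>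

lemma kurtz_random_above:
  assumes Q: "universal_pi11 Q" and y: "real_of_pairs C \<le>\<^sub>h y"
    and C: "C = {(n, \<sigma>). mu_null (slice Q n) \<and> (\<exists>x. (n, x) \<in> Q \<and> \<sigma> \<prec> x)}"
  shows "\<exists>z. z \<equiv>\<^sub>h y \<and> pi11_kurtz_random z"
proof -
  obtain A z where A: "coding (real_of_pairs C) y A z"
    using coding_exists by blast
  have "z \<notin> F" if F: "closed F" "mu_null F" "pi11 F" for F
  proof -
    obtain n where n: "F = slice Q n" using Q F(3) unfolding universal_pi11_def by blast
    then have "real_of_pairs C (prod_encode (n, string_code \<sigma>)) \<longleftrightarrow> (\<exists>x\<in>F. \<sigma> \<prec> x)" for \<sigma>
      using F(2) unfolding real_of_pairs_iff C slice_def by auto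
    then show ?thesis using coding_avoids[OF A] F by blast
  qed
  then have "pi11_kurtz_random z" unfolding pi11_kurtz_random_def by blast
  moreover have "z \<equiv>\<^sub>h y"
    unfolding hyp_equiv_def
    using coding_hyp_le[OF y A] coding_decode_hyp_le[OF coding_decode[OF A]] by blast
  ultimately show ?thesis by blast
qed

theorem theorem3p5:
  fixes Q :: "(nat \<times> cantor) set" and x0 :: "nat set"
    and C :: "(nat \<times> bool list) set" and c :: cantor
  assumes "universal_pi11 Q"
    and "x0 = {n. mu_null (slice Q n)}"
    and "C = {(n, \<sigma>). n \<in> x0 \<and> (\<exists>x. (n, x) \<in> Q \<and> \<sigma> \<prec> x)}"
    and "c = real_of_pairs C"
  shows "kurtz_cone_base (hyperdegree c) \<and>
    (\<forall>y0. c \<le>\<^sub>h y0 \<longrightarrow> (\<exists>z. z \<equiv>\<^sub>h y0 \<and> pi11_kurtz_random z))"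
proof -
  have cone: "\<exists>z. z \<equiv>\<^sub>h y \<and> pi11_kurtz_random z" if "c \<le>\<^sub>h y" for y
    using kurtz_random_above[OF assms(1)] assms(2-4) that by simp
  have "\<exists>z\<in>hyperdegree y. pi11_kurtz_random z"
    if le: "hyperdegree_le (hyperdegree c) (hyperdegree y)" for y
  proof -
    obtain u v where "u \<equiv>\<^sub>h c" "v \<equiv>\<^sub>h y" "u \<le>\<^sub>h v"
      using le unfolding hyperdegree_le_def hyperdegree_def by blast
    then have "c \<le>\<^sub>h y" unfolding hyp_equiv_def using hyp_le_trans by blast
    then show ?thesis using cone unfolding hyperdegree_def by blast
  qed
  then show ?thesis unfolding kurtz_cone_base_def using cone by blast
qed

end
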